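(* Let $0\le r\le n$ and $\wp\in P^{2n}$. The space of matrices of rank $\le r$ in $M(n,\mathbb C)$ is preserved by Hamiltonian flow for the modified Poisson structure $\{\cdot,\cdot\}_\wp$: every integral curve of a Hamiltonian vector field of $\{\cdot,\cdot\}_\wp$ starting at a matrix of rank $\le r$ consists of matrices of rank $\le r$.
   Context: $P$ is the free abelian group with basis $\lambda_\beta,\lambda_{\mu_1},\dots,\lambda_{\mu_{n-1}},\lambda_{\nu_1},\dots,\lambda_{\nu_{n-1}}$. For $1\le i,j\le n$ the symbols $\alpha_{i,j}$ pair additively with $P$ by $(\lambda_\beta|\alpha_{i,j})=1$, $(\lambda_{\mu_k}|\alpha_{i,j})=1$ if $k<i$ and $0$ otherwise, $(\lambda_{\nu_k}|\alpha_{i,j})=1$ if $k<j$ and $0$ otherwise; $(\alpha|\lambda)=(\lambda|\alpha)$. Let $a_{ij}$ be the coordinate functions on $M(n,\mathbb C)$. The standard Poisson bracket is determined by antisymmetry, the Leibniz rule and $\{a_{ij},a_{ik}\}_0=a_{ij}a_{ik}$ if $j<k$; $\{a_{ij},a_{kj}\}_0=a_{ij}a_{kj}$ if $i<k$; $\{a_{ij},a_{st}\}_0=0$ if $i<s$, $t<j$; $\{a_{ij},a_{st}\}_0=2a_{it}a_{sj}$ if $i<s$, $j<t$. For $\wp=(\zeta_1,\dots,\zeta_n,\xi_1,\dots,\xi_n)\in P^{2n}$ the modified Poisson structure is $$\{a_{ij},a_{st}\}_\wp=\{a_{ij},a_{st}\}_0+\big((\alpha_{s,t}|\zeta_i+\xi_j)-(\alpha_{i,j}|\zeta_s+\xi_t)\big)a_{ij}a_{st}.$$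 The Hamiltonian vector field of a $C^\infty$-function $f$ is $\theta_f=\sum_{i,j}\frac{\partial f}{\partial a_{ij}}\theta_{ij}$, where $\theta_{ij}=\sum_{s,t}\{a_{ij},a_{st}\}_\wp\frac{\partial}{\partial a_{st}}$ (holomorphic partial derivatives; the value $\theta_f(a)$ is regarded as an element of $T_aM(n,\mathbb C)=M(n,\mathbb C)$). *)

theory Defs
  imports "HOL-Analysis.Analysis" "HOL-Algebra.Free_Abelian_Groups"
begin

text \<open>
  The index set \<open>{1..n}\<close> is an arbitrary finite linearly ordered type \<open>'n\<close>, with \<open>n = CARD('n)\<close>;
  the subset \<open>{1..n-1}\<close> is then \<open>{..< Max UNIV}\<close>. The space \<open>M(n, \<complex>)\<close> is \<open>complex ^ 'n ^ 'n\<close>,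
  viewed as a real normed vector space, and \<open>a $ i $ j\<close> is the entry in row \<open>i\<close> and column \<open>j\<close>.
\<close>

type_synonym 'n cmat = "((complex, 'n) vec, 'n) vec"

section \<open>The weight lattice\<close>

datatype 'n weight_basis = Lam_beta | Lam_mu 'n | Lam_nu 'n

definition weight_gens :: "('n::{finite,linorder}) weight_basis set"
  where "weight_gens = {Lam_beta} \<union> Lam_mu ` {..< Max UNIV} \<union> Lam_nu ` {..< Max UNIV}"

definition weight_lattice :: "(('n::{finite,linorder}) weight_basis \<Rightarrow>\<^sub>0 int) monoid"
  where "weight_lattice = free_Abelian_group weight_gens"

fun basis_pairing :: "('n::{finite,linorder}) weight_basis \<Rightarrow> 'n \<Rightarrow> 'n \<Rightarrow> int"
  where
    "basis_pairing Lam_beta i j = 1"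
  | "basis_pairing (Lam_mu k) i j = (if k < i then 1 else 0)"
  | "basis_pairing (Lam_nu k) i j = (if k < j then 1 else 0)"

text \<open>\<open>pairing i j \<lambda>\<close> is \<open>(\<alpha>\<^sub>i\<^sub>j | \<lambda>) = (\<lambda> | \<alpha>\<^sub>i\<^sub>j)\<close>.\<close>

definition pairing :: "'n \<Rightarrow> 'n \<Rightarrow> (('n::{finite,linorder}) weight_basis \<Rightarrow>\<^sub>0 int) \<Rightarrow> int"
  where "pairing i j l = (\<Sum>b\<in>Poly_Mapping.keys l. Poly_Mapping.lookup l b * basis_pairing b i j)"

lemma pairing_frag_of [simp]: "pairing i j (frag_of b) = basis_pairing b i j"
  by (simp add: pairing_def)

lemma pairing_superset:
  assumes "finite A" "Poly_Mapping.keys l \<subseteq> A"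
  shows "pairing i j l = (\<Sum>b\<in>A. Poly_Mapping.lookup l b * basis_pairing b i j)"
  unfolding pairing_def
  by (rule sum.mono_neutral_left) (use assms in \<open>auto simp: in_keys_iff\<close>)

lemma pairing_add: "pairing i j (l + m) = pairing i j l + pairing i j m"
proof -
  let ?A = "Poly_Mapping.keys l \<union> Poly_Mapping.keys m"
  have "Poly_Mapping.keys (l + m) \<subseteq> ?A"
    by (rule Poly_Mapping.keys_add)
  then show ?thesis
    by (simp add: pairing_superset[of ?A] lookup_add distrib_right sum.distrib)
qed

section \<open>Poisson brackets of coordinate functions\<close>

text \<open>
  \<open>std_bracket i j s t a\<close> is the value of \<open>{a\<^sub>i\<^sub>j, a\<^sub>s\<^sub>t}\<^sub>0\<close> at the matrix \<open>a\<close>. The pairs of generators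
  whose bracket is prescribed to be nonzero are collected in \<open>bracket_half\<close>; no pair occurs there in
  both orders, so antisymmetrizing yields the bracket on all pairs of generators.
\<close>

definition bracket_half ::
    "'n \<Rightarrow> 'n \<Rightarrow> 'n \<Rightarrow> 'n \<Rightarrow> ('n::{finite,linorder}) cmat \<Rightarrow> complex"
  where "bracket_half i j s t a =
    (if i = s \<and> j < t \<or> i < s \<and> j = t then a $ i $ j * a $ s $ t
     else if i < s \<and> j < t then 2 * a $ i $ t * a $ s $ j
     else 0)"

definition std_bracket ::
    "'n \<Rightarrow> 'n \<Rightarrow> 'n \<Rightarrow> 'n \<Rightarrow> ('n::{finite,linorder}) cmat \<Rightarrow> complex"
  where "std_bracket i j s t a = bracket_half i j s t a - bracket_half s t i j a"

lemma std_bracket_antisym: "std_bracket s t i j a = - std_bracket i j s t a"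
  by (simp add: std_bracket_def)

lemma std_bracket_row: "j < k \<Longrightarrow> std_bracket i j i k a = a $ i $ j * a $ i $ k"
  by (simp add: std_bracket_def bracket_half_def)

lemma std_bracket_col: "i < k \<Longrightarrow> std_bracket i j k j a = a $ i $ j * a $ k $ j"
  by (simp add: std_bracket_def bracket_half_def)

lemma std_bracket_anti_diag: "i < s \<Longrightarrow> t < j \<Longrightarrow> std_bracket i j s t a = 0"
  by (auto simp: std_bracket_def bracket_half_def)

lemma std_bracket_diag:
  "i < s \<Longrightarrow> j < t \<Longrightarrow> std_bracket i j s t a = 2 * a $ i $ t * a $ s $ j"
  by (auto simp: std_bracket_def bracket_half_def)

text \<open>The tuple \<open>(\<zeta>\<^sub>1, \<dots>, \<zeta>\<^sub>n, \<xi>\<^sub>1, \<dots>, \<xi>\<^sub>n)\<close> is passed as the two families \<open>\<zeta>\<close> and \<open>\<xi>\<close>.\<close>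

definition mod_bracket ::
    "('n \<Rightarrow> 'n weight_basis \<Rightarrow>\<^sub>0 int) \<Rightarrow> ('n \<Rightarrow> 'n weight_basis \<Rightarrow>\<^sub>0 int) \<Rightarrow>
      'n \<Rightarrow> 'n \<Rightarrow> 'n \<Rightarrow> 'n \<Rightarrow> ('n::{finite,linorder}) cmat \<Rightarrow> complex"
  where "mod_bracket \<zeta> \<xi> i j s t a =
    std_bracket i j s t a
    + of_int (pairing s t (\<zeta> i + \<xi> j) - pairing i j (\<zeta> s + \<xi> t)) * (a $ i $ j * a $ s $ t)"

section \<open>Smooth functions and Hamiltonian vector fields\<close>

text \<open>Differentiability classes over the reals; no holomorphy is required.\<close>

fun times_differentiable :: "nat \<Rightarrow> ('a::real_normed_vector \<Rightarrow> 'b::real_normed_vector) \<Rightarrow> bool"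
  where
    "times_differentiable 0 f \<longleftrightarrow> continuous_on UNIV f"
  | "times_differentiable (Suc k) f \<longleftrightarrow>
      (\<forall>x. f differentiable (at x)) \<and>
      (\<forall>v. times_differentiable k (\<lambda>x. frechet_derivative f (at x) v))"

definition smooth :: "('a::real_normed_vector \<Rightarrow> 'b::real_normed_vector) \<Rightarrow> bool"
  where "smooth f \<longleftrightarrow> (\<forall>k. times_differentiable k f)"

text \<open>
  The holomorphic (Wirtinger) partial derivative: with \<open>a\<^sub>i\<^sub>j = x + \<i> y\<close>, it is
  \<open>\<partial>/\<partial>a\<^sub>i\<^sub>j = (\<partial>/\<partial>x - \<i> \<partial>/\<partial>y) / 2\<close>.
\<close>

definition hol_partial ::
    "'n \<Rightarrow> 'n \<Rightarrow> (('n::finite) cmat \<Rightarrow> complex) \<Rightarrow> 'n cmat \<Rightarrow> complex"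
  where "hol_partial i j f a =
    (frechet_derivative f (at a) (axis i (axis j 1))
     - \<i> * frechet_derivative f (at a) (axis i (axis j \<i>))) / 2"

text \<open>
  Tangent vectors are matrices, the holomorphic field \<open>\<partial>/\<partial>a\<^sub>s\<^sub>t\<close> being the matrix unit at position
  \<open>(s, t)\<close>.
\<close>

definition coord_field ::
    "('n \<Rightarrow> 'n weight_basis \<Rightarrow>\<^sub>0 int) \<Rightarrow> ('n \<Rightarrow> 'n weight_basis \<Rightarrow>\<^sub>0 int) \<Rightarrow>
      'n \<Rightarrow> 'n \<Rightarrow> ('n::{finite,linorder}) cmat \<Rightarrow> 'n cmat"
  where "coord_field \<zeta> \<xi> i j a = (\<chi> s t. mod_bracket \<zeta> \<xi> i j s t a)"

definition hamiltonian_field ::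
    "('n \<Rightarrow> 'n weight_basis \<Rightarrow>\<^sub>0 int) \<Rightarrow> ('n \<Rightarrow> 'n weight_basis \<Rightarrow>\<^sub>0 int) \<Rightarrow>
      ('n cmat \<Rightarrow> complex) \<Rightarrow> ('n::{finite,linorder}) cmat \<Rightarrow> 'n cmat"
  where "hamiltonian_field \<zeta> \<xi> f a =
    (\<chi> s t. \<Sum>i\<in>UNIV. \<Sum>j\<in>UNIV. hol_partial i j f a * coord_field \<zeta> \<xi> i j a $ s $ t)"

text \<open>At endpoints of \<open>I\<close> belonging to \<open>I\<close> the derivative is one-sided.\<close>

definition integral_curve ::
    "('a::real_normed_vector \<Rightarrow> 'a) \<Rightarrow> real set \<Rightarrow> (real \<Rightarrow> 'a) \<Rightarrow> bool"
  where "integral_curve X I \<gamma> \<longleftrightarrow>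
    is_interval I \<and> (\<forall>t\<in>I. (\<gamma> has_vector_derivative X (\<gamma> t)) (at t within I))"

end

theory Submission
  imports Defs
begin

text \<open>
  Every Hamiltonian field of the modified bracket has the form \<open>X a = L a ** a + a ** R a\<close> with
  continuous matrix functions \<open>L\<close> and \<open>R\<close>, that is, it is tangent to the orbits of left and right
  multiplication by invertible matrices, which preserve the rank.

  For the coordinate fields this holds since, with the sign \<open>\<epsilon>\<close> of a difference of indices,
  \<open>{a\<^sub>i\<^sub>j, a\<^sub>s\<^sub>t}\<^sub>0 = (\<epsilon>(s - i) + \<epsilon>(t - j)) a\<^sub>s\<^sub>j a\<^sub>i\<^sub>t\<close>, a row scaling and a column scaling of the matrix
  \<open>(a e\<^sub>j) (e\<^sub>i\<^sup>T a)\<close>; and since \<open>(\<alpha>\<^sub>s\<^sub>t | \<lambda>)\<close> is a function of \<open>s\<close> plus a function of \<open>t\<close>, so that the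
  modification scales the rows and the columns of \<open>a\<close> itself
  (\<open>orbit_tangent_coord_field\<close>). Hamiltonian fields are combinations of these with continuous function
  coefficients (\<open>orbit_tangent_hamiltonian_field\<close>).

  An integral curve \<open>\<gamma>\<close> therefore solves a linear equation \<open>\<gamma>' = A \<gamma> + \<gamma> B\<close> with coefficients that are
  continuous in time. It is the limit of the Euler products of the maps
  \<open>M \<mapsto> (1 + h A) M (1 + h B)\<close>, none of which raises the rank (\<open>rank_le_forward\<close>). As the set of
  matrices of rank at most \<open>r\<close> is closed (\<open>closed_rank_le\<close>), the limit stays in it. Reversing time
  treats the past of the initial point.
\<close>

section \<open>The rank of a matrix\<close>

lemma rank_mult_le_right:
  fixes A :: "'a::field^'m^'k" and B :: "'a^'n^'m"
  shows "rank (A ** B) \<le> rank B"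
proof -
  have "row i (A ** B) = (\<Sum>k\<in>UNIV. A $ i $ k *s row k B)" for i
    by (simp add: vec_eq_iff row_def matrix_matrix_mult_def)
  then have "row i (A ** B) \<in> vec.span (rows B)" for i
    by (force simp: rows_def intro: vec.span_sum vec.span_scale vec.span_base)
  then have "rows (A ** B) \<subseteq> vec.span (rows B)"
    by (auto simp: rows_def)
  then have "vec.dim (rows (A ** B)) \<le> vec.dim (vec.span (rows B))"
    by (rule vec.dim_subset)
  then show ?thesis
    by (simp add: row_rank_def_gen)
qed

lemma rank_mult_le_left:
  fixes A :: "'a::field^'m^'k" and B :: "'a^'n^'m"
  shows "rank (A ** B) \<le> rank A"
proof -
  have "row i (A ** B) = transpose B *v row i A" for i
    by (simp add: vec_eq_iff row_def matrix_matrix_mult_def matrix_vector_mult_def transpose_def mult.commute)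
  then have "rows (A ** B) = (*v) (transpose B) ` rows A"
    by (auto simp: rows_def)
  then show ?thesis
    unfolding row_rank_def_gen
    by (metis vec.dim_image_le matrix_vector_mul_linear_gen)
qed

lemma basis_of_rows:
  fixes a :: "'a::field^'n^'n"
  obtains J where "card J = rank a" "inj_on (\<lambda>i. a $ i) J" "vec.independent ((\<lambda>i. a $ i) ` J)"
proof -
  obtain B where B: "B \<subseteq> rows a" "vec.independent B" "card B = vec.dim (rows a)"
    by (metis vec.basis_exists)
  have "rows a = (\<lambda>i. a $ i) ` UNIV"
    by (auto simp: rows_def row_def)
  with B obtain J where "inj_on (\<lambda>i. a $ i) J" "B = (\<lambda>i. a $ i) ` J"
    by (metis subset_image_inj)
  with B that show ?thesis
    by (metis card_image row_rank_def_gen)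
qed

text \<open>
  The new rows are a bijective enumeration of the vectors that extend the chosen rows to a basis of
  the row space. The nonvanishing determinant certifies the independence of the rows in \<open>J\<close> and,
  unlike the independence itself, is visibly an open condition on \<open>a\<close>.
\<close>

lemma complete_rows_to_basis:
  fixes a :: "'a::field^'n^'n"
  assumes "inj_on (\<lambda>i. a $ i) J" "vec.independent ((\<lambda>i. a $ i) ` J)"
  obtains h where "det (\<chi> i. if i \<in> J then a $ i else h i) \<noteq> 0"
proof -
  let ?B = "(\<lambda>i. a $ i) ` J"
  obtain C where C: "?B \<subseteq> C" "vec.independent C" "UNIV \<subseteq> vec.span C"
    using vec.maximal_independent_subset_extend[OF subset_UNIV assms(2)] by metis
  have fin: "finite C"
    using C(2) vec.finiteI_independent by blast
  have "card C = vec.dim (UNIV :: ('a^'n) set)"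
    by (rule vec.basis_card_eq_dim[OF subset_UNIV C(3,2)])
  then have cardC: "card C = CARD('n)"
    unfolding vec_dim_card .
  have "card (C - ?B) = card (- J)"
    using C(1) fin assms(1) cardC
    by (simp add: card_Diff_subset card_image Compl_eq_Diff_UNIV)
  then obtain h where h: "bij_betw h (- J) (C - ?B)"
    using fin by (metis finite_class.finite finite_Diff finite_same_card_bij)
  let ?c = "\<chi> i. if i \<in> J then a $ i else h i"
  have "C \<subseteq> rows ?c"
  proof
    fix v assume "v \<in> C"
    then consider i where "i \<in> J" "v = a $ i" | i where "i \<notin> J" "v = h i"
      using h by (fastforce simp: bij_betw_def)
    then show "v \<in> rows ?c"
      by cases (force simp: rows_def row_def)+
  qed
  then have "vec.span (rows ?c) = UNIV"
    using C(3) vec.span_mono[of C "rows ?c"] by auto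
  then have "invertible ?c"
    by (metis invertible_left_inverse matrix_left_invertible_span_rows_gen)
  then show ?thesis
    using that invertible_det_nz by blast
qed

text \<open>
  Converse certificate: a basis of the row space of \<open>a\<close> together with the \<open>n - card J\<close> vectors
  \<open>h i\<close> spans everything, so it has at least \<open>n\<close> members.
\<close>

lemma rank_ge_if_completion_nonsingular:
  fixes a :: "'a::field^'n^'n"
  assumes "det (\<chi> i. if i \<in> J then a $ i else h i) \<noteq> 0"
  shows "card J \<le> rank a"
proof -
  let ?c = "\<chi> i. if i \<in> J then a $ i else h i"
  have "invertible ?c"
    using assms invertible_det_nz by blast
  then have span: "vec.span (rows ?c) = UNIV"
    by (metis invertible_left_inverse matrix_left_invertible_span_rows_gen)
  obtain B where B: "B \<subseteq> rows a" "rows a \<subseteq> vec.span B" "vec.independent B" "card B = vec.dim (rows a)"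
    by (metis vec.basis_exists)
  have finB: "finite B"
    using B(3) vec.finiteI_independent by blast
  have "rows ?c \<subseteq> vec.span (B \<union> h ` (- J))"
  proof
    fix v assume "v \<in> rows ?c"
    then obtain i where i: "v = ?c $ i"
      by (auto simp: rows_def row_def)
    show "v \<in> vec.span (B \<union> h ` (- J))"
    proof (cases "i \<in> J")
      case True
      then have "v \<in> rows a"
        using i by (auto simp: rows_def row_def)
      then show ?thesis
        using B(2) vec.span_mono[of B "B \<union> h ` (- J)"] by blast
    next
      case False
      then show ?thesis
        using i by (auto intro: vec.span_base)
    qed
  qed
  then have "UNIV \<subseteq> vec.span (B \<union> h ` (- J))"
    unfolding span[symmetric] by (rule vec.span_minimal[OF _ vec.subspace_span])
  then have "vec.dim (UNIV :: ('a^'n) set) \<le> card (B \<union> h ` (- J))"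
    using finB by (intro vec.dim_le_card) auto
  also have "\<dots> \<le> card B + card (- J)"
    by (rule order_trans[OF card_Un_le add_left_mono[OF card_image_le]]) simp
  also have "card (- J) = CARD('n) - card J"
    by (simp add: Compl_eq_Diff_UNIV card_Diff_subset)
  finally have "CARD('n) \<le> rank a + (CARD('n) - card J)"
    unfolding vec_dim_card row_rank_def_gen B(4) .
  moreover have "card J \<le> CARD('n)"
    by (simp add: card_mono)
  ultimately show ?thesis
    by linarith
qed

text \<open>
  Near a matrix of rank \<open>k\<close> the rank is at least \<open>k\<close>: complete \<open>k\<close> independent rows, with fixed
  vectors \<open>h i\<close>, to a matrix of nonzero determinant. The determinant stays nonzero near \<open>a\<close>.
\<close>

lemma closed_rank_le: "closed {a :: 'n::finite cmat. rank a \<le> r}"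
proof -
  have "\<exists>U. open U \<and> a \<in> U \<and> U \<subseteq> - {a. rank a \<le> r}" if "\<not> rank a \<le> r" for a :: "'n cmat"
  proof -
    obtain J where J: "card J = rank a" "inj_on (($) a) J" "vec.independent (($) a ` J)"
      by (rule basis_of_rows)
    obtain h where h: "det (\<chi> i. if i \<in> J then a $ i else h i) \<noteq> 0"
      by (rule complete_rows_to_basis[OF J(2,3)])
    let ?g = "\<lambda>b :: 'n cmat. det (\<chi> i. if i \<in> J then b $ i else h i)"
    have "continuous_on UNIV ?g"
    proof -
      have "continuous_on UNIV (\<lambda>b :: 'n cmat. if i \<in> J then b $ i else h i)" for i
        by (cases "i \<in> J") (auto intro!: continuous_intros)
      then show ?thesis
        unfolding det_def by (auto intro!: continuous_intros)
    qed
    then have "open {b. ?g b \<noteq> 0}"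
      by (intro open_Collect_neq continuous_intros)
    moreover have "{b. ?g b \<noteq> 0} \<subseteq> - {a. rank a \<le> r}"
      using rank_ge_if_completion_nonsingular[of J _ h] J(1) that by force
    ultimately show ?thesis
      using h by blast
  qed
  then have "open (- {a :: 'n cmat. rank a \<le> r})"
    by (subst open_subopen) simp
  then show ?thesis
    by (simp add: closed_def)
qed

section \<open>Linear flows by left and right multiplication\<close>

lemma matrix_mult_add_left: "(A + B) ** C = A ** C + B ** (C :: 'a::semiring_1^'n^'m)"
  by (simp add: vec_eq_iff matrix_matrix_mult_def distrib_right sum.distrib)

lemma bounded_bilinear_matrix_mult:
  "bounded_bilinear ((**) :: 'n::finite cmat \<Rightarrow> 'n cmat \<Rightarrow> 'n cmat)"
proof -
  have "bilinear ((**) :: 'n cmat \<Rightarrow> 'n cmat \<Rightarrow> 'n cmat)"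
    unfolding bilinear_def
    by (auto intro!: linearI simp: matrix_add_ldistrib matrix_mult_add_left matrix_scalar_ac scalar_matrix_assoc)
  then show ?thesis
    by (simp add: bilinear_conv_bounded_bilinear)
qed

text \<open>
  One Euler step of size \<open>h\<close> for the linear equation \<open>M' = A M + M B\<close>, modified to second order in
  \<open>h\<close>. The additive step \<open>M + h (A M + M B)\<close> may raise the rank; the product form cannot.
\<close>

definition euler_step :: "real \<Rightarrow> 'n cmat \<Rightarrow> 'n cmat \<Rightarrow> ('n::finite) cmat \<Rightarrow> 'n cmat"
  where "euler_step h A B M = (mat 1 + h *\<^sub>R A) ** M ** (mat 1 + h *\<^sub>R B)"

lemma rank_euler_step_le: "rank (euler_step h A B M) \<le> rank M"
  unfolding euler_step_def by (meson le_trans rank_mult_le_left rank_mult_le_right)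

lemma euler_step_expand:
  "euler_step h A B M = M + h *\<^sub>R (A ** M + M ** B) + h\<^sup>2 *\<^sub>R (A ** M ** B)"
  by (simp add: euler_step_def matrix_add_ldistrib matrix_mult_add_left matrix_scalar_ac
      scalar_matrix_assoc[symmetric] scaleR_add_right power2_eq_square)

interpretation matmul: bounded_bilinear "(**) :: 'n::finite cmat \<Rightarrow> 'n cmat \<Rightarrow> 'n cmat"
  by (rule bounded_bilinear_matrix_mult)

lemma euler_step_diff: "euler_step h A B (M - N) = euler_step h A B M - euler_step h A B N"
  by (simp add: euler_step_def matmul.diff_left matmul.diff_right)

text \<open>
  The factor \<open>c\<close> is a constant of continuity of the matrix product, so that \<open>K\<close> bounds multiplication
  by \<open>A\<close> and by \<open>B\<close> as operators. The first bound, \<open>(1 + K h)\<^sup>2\<close> in its sharp form, is stated with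
  an exponential because the exponential bounds of consecutive steps multiply exactly.
\<close>

lemma euler_step_bounds:
  fixes A B D :: "'n::finite cmat"
  assumes c: "\<And>(X :: 'n cmat) (Y :: 'n cmat). norm (X ** Y) \<le> norm X * norm Y * c"
    and K: "0 < c" "norm A * c \<le> K" "norm B * c \<le> K" and "0 \<le> h"
  shows "norm (euler_step h A B D) \<le> exp (2 * K * h) * norm D"
    and "norm (euler_step h A B D - (D + h *\<^sub>R (A ** D + D ** B))) \<le> h\<^sup>2 * K\<^sup>2 * norm D"
    and "norm (A ** D + D ** B) \<le> 2 * K * norm D"
proof -
  have K0: "0 \<le> K"
    by (rule order_trans[OF _ K(2)]) (simp add: K(1) less_imp_le)
  have AX: "norm (A ** X) \<le> K * norm X" and XB: "norm (X ** B) \<le> K * norm X" for X :: "'n cmat"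
    using c[of A X] c[of X B] mult_right_mono[OF K(2), of "norm X"] mult_right_mono[OF K(3), of "norm X"]
    by (auto simp: mult_ac)
  show AD: "norm (A ** D + D ** B) \<le> 2 * K * norm D"
    using norm_triangle_ineq[of "A ** D" "D ** B"] AX[of D] XB[of D] by linarith
  have ADB: "norm (A ** D ** B) \<le> K\<^sup>2 * norm D"
    using XB[of "A ** D"] mult_left_mono[OF AX[of D] K0] by (simp add: power2_eq_square mult.assoc)
  then show "norm (euler_step h A B D - (D + h *\<^sub>R (A ** D + D ** B))) \<le> h\<^sup>2 * K\<^sup>2 * norm D"
    using mult_left_mono[of _ _ "h\<^sup>2"] by (simp add: euler_step_expand mult.assoc)
  have "norm (h *\<^sub>R (A ** D + D ** B)) \<le> h * (2 * K * norm D)"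
    using mult_left_mono[OF AD \<open>0 \<le> h\<close>] \<open>0 \<le> h\<close> by simp
  moreover have "norm (euler_step h A B D) \<le> norm D + norm (h *\<^sub>R (A ** D + D ** B))
      + norm (h\<^sup>2 *\<^sub>R (A ** D ** B))"
    unfolding euler_step_expand
    by (rule order_trans[OF norm_triangle_ineq add_right_mono[OF norm_triangle_ineq]])
  moreover have "norm (h\<^sup>2 *\<^sub>R (A ** D ** B)) \<le> h\<^sup>2 * (K\<^sup>2 * norm D)"
    using mult_left_mono[OF ADB, of "h\<^sup>2"] by simp
  ultimately have "norm (euler_step h A B D) \<le> (1 + K * h)\<^sup>2 * norm D"
    by (simp add: power2_eq_square algebra_simps)
  also have "\<dots> \<le> (exp (K * h))\<^sup>2 * norm D"
    using K0 \<open>0 \<le> h\<close> by (intro mult_right_mono power_mono exp_ge_add_one_self) auto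
  also have "(exp (K * h))\<^sup>2 = exp (2 * K * h)"
    by (simp add: power2_eq_square flip: exp_add)
  finally show "norm (euler_step h A B D) \<le> exp (2 * K * h) * norm D" .
qed

text \<open>
  The local error is uniform over steps from \<open>u\<close> to \<open>v\<close> that straddle \<open>x\<close>, with the coefficients
  frozen at \<open>x\<close>. Three errors of order \<open>o(v - u)\<close> add up: of \<open>\<gamma>\<close> against its tangent at \<open>x\<close>, of
  the velocity on replacing \<open>\<gamma> x\<close> by \<open>\<gamma> u\<close>, and of the product step against the additive step.
\<close>

lemma euler_step_local_error:
  fixes \<gamma> :: "real \<Rightarrow> 'n::finite cmat"
  assumes der: "(\<gamma> has_vector_derivative A ** \<gamma> x + \<gamma> x ** B) (at x within I)"
    and c: "\<And>(X :: 'n cmat) (Y :: 'n cmat). norm (X ** Y) \<le> norm X * norm Y * c"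
    and K: "0 < c" "norm A * c \<le> K" "norm B * c \<le> K"
    and "x \<in> I" "0 < e"
  shows "\<exists>d>0. \<forall>u\<in>I. \<forall>v\<in>I. u \<le> x \<longrightarrow> x \<le> v \<longrightarrow> v - u < d \<longrightarrow>
      norm (\<gamma> v - euler_step (v - u) A B (\<gamma> u)) \<le> e * (v - u)"
proof -
  have K0: "0 \<le> K"
    by (rule order_trans[OF _ K(2)]) (simp add: K(1) less_imp_le)
  define V where "V = A ** \<gamma> x + \<gamma> x ** B"
  define \<eta> where "\<eta> = e / (2 + 2 * K)"
  have \<eta>: "0 < \<eta>" "\<eta> * (2 + 2 * K) = e"
    using \<open>0 < e\<close> K0 by (auto simp: \<eta>_def)
  have "\<exists>d>0. \<forall>y\<in>I. norm (y - x) < d \<longrightarrow> norm (\<gamma> y - \<gamma> x - (y - x) *\<^sub>R V) \<le> \<eta> * norm (y - x)"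
    using der \<eta>(1) unfolding has_vector_derivative_def has_derivative_within_alt V_def by blast
  then obtain d1 where d1: "d1 > 0"
    "\<And>y. y \<in> I \<Longrightarrow> \<bar>y - x\<bar> < d1 \<Longrightarrow> norm (\<gamma> y - \<gamma> x - (y - x) *\<^sub>R V) \<le> \<eta> * \<bar>y - x\<bar>"
    by auto
  have "continuous (at x within I) \<gamma>"
    using der has_vector_derivative_continuous by blast
  then obtain d2 where d2: "d2 > 0" "\<And>y. y \<in> I \<Longrightarrow> \<bar>y - x\<bar> < d2 \<Longrightarrow> norm (\<gamma> y - \<gamma> x) < \<eta>"
    using \<eta>(1) unfolding continuous_within_eps_delta dist_norm real_norm_def by metis
  \<comment> \<open>The second-order term of a step is at most h * (h * N); the summand 1 makes N positive,
  so that d may be chosen at most \<eta> / N.\<close>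
  define N where "N = K\<^sup>2 * (norm (\<gamma> x) + \<eta>) + 1"
  have N: "N > 0"
    using \<eta>(1) unfolding N_def by (intro add_nonneg_pos) auto
  define d where "d = min (min d1 d2) (\<eta> / N)"
  have "d > 0"
    using d1 d2 \<eta> N by (simp add: d_def)
  moreover have "norm (\<gamma> v - euler_step (v - u) A B (\<gamma> u)) \<le> e * (v - u)"
    if uv: "u \<in> I" "v \<in> I" "u \<le> x" "x \<le> v" "v - u < d" for u v
  proof -
    define h where "h = v - u"
    have h: "0 \<le> h" "h < d1" "h < d2" "h < \<eta> / N"
      using uv by (auto simp: h_def d_def)
    have "norm (\<gamma> v - \<gamma> x - (v - x) *\<^sub>R V) \<le> \<eta> * (v - x)"
      "norm (\<gamma> u - \<gamma> x - (u - x) *\<^sub>R V) \<le> \<eta> * (x - u)"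
      using d1(2)[of v] d1(2)[of u] uv h by (auto simp: h_def)
    moreover have "\<gamma> v - \<gamma> u - h *\<^sub>R V = (\<gamma> v - \<gamma> x - (v - x) *\<^sub>R V) - (\<gamma> u - \<gamma> x - (u - x) *\<^sub>R V)"
      by (simp add: h_def algebra_simps)
    ultimately have "norm (\<gamma> v - \<gamma> u - h *\<^sub>R V) \<le> \<eta> * (v - x) + \<eta> * (x - u)"
      using order_trans[OF norm_triangle_ineq4 add_mono] by metis
    then have 1: "norm (\<gamma> v - \<gamma> u - h *\<^sub>R V) \<le> \<eta> * h"
      by (simp add: h_def algebra_simps)
    define W where "W = A ** (\<gamma> x - \<gamma> u) + (\<gamma> x - \<gamma> u) ** B"
    have close: "norm (\<gamma> u - \<gamma> x) < \<eta>"
      using d2(2)[of u] uv h by (auto simp: h_def)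
    have "norm W \<le> 2 * K * norm (\<gamma> x - \<gamma> u)"
      unfolding W_def using euler_step_bounds(3)[OF c K order_refl] by blast
    also have "\<dots> \<le> 2 * K * \<eta>"
      using close K0 by (intro mult_left_mono) (auto simp: norm_minus_commute)
    finally have "norm (h *\<^sub>R W) \<le> h * (2 * K * \<eta>)"
      using h(1) by (simp add: mult_left_mono)
    moreover have "h *\<^sub>R W = h *\<^sub>R V - h *\<^sub>R (A ** \<gamma> u + \<gamma> u ** B)"
      by (simp add: W_def V_def matmul.diff_left matmul.diff_right algebra_simps)
    ultimately have 2: "norm (h *\<^sub>R V - h *\<^sub>R (A ** \<gamma> u + \<gamma> u ** B)) \<le> h * (2 * K * \<eta>)"
      by simp
    have "norm (euler_step h A B (\<gamma> u) - (\<gamma> u + h *\<^sub>R (A ** \<gamma> u + \<gamma> u ** B))) \<le> h\<^sup>2 * K\<^sup>2 * norm (\<gamma> u)"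
      using euler_step_bounds(2)[OF c K h(1)] by blast
    also have "\<dots> \<le> h * (h * N)"
    proof -
      have "norm (\<gamma> u) \<le> norm (\<gamma> x) + \<eta>"
        using close norm_triangle_sub[of "\<gamma> u" "\<gamma> x"] by linarith
      then have "K\<^sup>2 * norm (\<gamma> u) \<le> N"
        unfolding N_def by (smt (verit) mult_left_mono zero_le_power2)
      then have "h\<^sup>2 * (K\<^sup>2 * norm (\<gamma> u)) \<le> h\<^sup>2 * N"
        by (intro mult_left_mono) auto
      then show ?thesis
        by (simp add: power2_eq_square mult_ac)
    qed
    also have "\<dots> \<le> h * \<eta>"
      using h N by (intro mult_left_mono) (auto simp: field_simps)
    finally have 3: "norm (euler_step h A B (\<gamma> u) - (\<gamma> u + h *\<^sub>R (A ** \<gamma> u + \<gamma> u ** B))) \<le> h * \<eta>" .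
    have "\<gamma> v - euler_step h A B (\<gamma> u) = (\<gamma> v - \<gamma> u - h *\<^sub>R V)
        + (h *\<^sub>R V - h *\<^sub>R (A ** \<gamma> u + \<gamma> u ** B))
        - (euler_step h A B (\<gamma> u) - (\<gamma> u + h *\<^sub>R (A ** \<gamma> u + \<gamma> u ** B)))"
      by simp
    also have "norm \<dots> \<le> \<eta> * h + h * (2 * K * \<eta>) + h * \<eta>"
      by (rule order_trans[OF norm_triangle_ineq4 add_mono[OF order_trans[OF norm_triangle_ineq add_mono[OF 1 2]] 3]])
    also have "\<dots> = \<eta> * (2 + 2 * K) * h"
      by (simp add: algebra_simps)
    finally show ?thesis
      unfolding \<eta>(2) h_def .
  qed
  ultimately show ?thesis
    by blast
qed

text \<open>
  The global error bound, obtained by bisection instead of by an explicit partition: from a matrix \<open>M\<close>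
  of rank at most \<open>r\<close> near \<open>\<gamma> u\<close>, Euler steps lead to a matrix of rank at most \<open>r\<close> near \<open>\<gamma> v\<close>, the
  distance growing by \<open>e (v - u)\<close> and a factor \<open>exp (2 K (v - u))\<close>. These estimates compose, and they
  hold for short intervals. Starting at \<open>M = \<gamma> a\<close> and letting \<open>e\<close> tend to 0 exhibits \<open>\<gamma> b\<close> as a
  limit of matrices of rank at most \<open>r\<close>.
\<close>

lemma rank_le_forward:
  fixes \<gamma> A B :: "real \<Rightarrow> 'n::finite cmat"
  assumes "a \<le> b"
    and der: "\<And>t. t \<in> {a..b} \<Longrightarrow>
      (\<gamma> has_vector_derivative A t ** \<gamma> t + \<gamma> t ** B t) (at t within {a..b})"
    and cont: "continuous_on {a..b} A" "continuous_on {a..b} B"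
    and "rank (\<gamma> a) \<le> r"
  shows "rank (\<gamma> b) \<le> r"
proof -
  obtain c where c: "0 < c" "\<And>(X :: 'n cmat) (Y :: 'n cmat). norm (X ** Y) \<le> norm X * norm Y * c"
    using matmul.pos_bounded by blast
  have "bounded (A ` {a..b} \<union> B ` {a..b})"
    using cont by (simp add: compact_continuous_image compact_imp_bounded)
  then obtain k where k: "\<And>t. t \<in> {a..b} \<Longrightarrow> norm (A t) \<le> k" "\<And>t. t \<in> {a..b} \<Longrightarrow> norm (B t) \<le> k"
    unfolding bounded_iff by blast
  define K where "K = k * c"
  have K: "norm (A t) * c \<le> K" "norm (B t) * c \<le> K" if "t \<in> {a..b}" for t
    using k[OF that] c(1) by (auto simp: K_def)
  have K0: "0 \<le> K"
    by (rule order_trans[OF _ K(1)[of a]]) (use c(1) \<open>a \<le> b\<close> in auto)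
  have approx: "\<exists>M'. rank M' \<le> r \<and> norm (\<gamma> b - M') \<le> exp (2 * K * (b - a)) * (norm (\<gamma> a - M) + e * (b - a))"
    if "rank M \<le> r" and e: "0 < e" for M e
  proof -
    \<comment> \<open>The bounds on u and v are part of P because the bisection principle asks for
    small intervals around x that may leave {a..b}.\<close>
    define P where "P u v \<longleftrightarrow> (a \<le> u \<longrightarrow> v \<le> b \<longrightarrow> (\<forall>M. rank M \<le> r \<longrightarrow> (\<exists>M'. rank M' \<le> r \<and>
      norm (\<gamma> v - M') \<le> exp (2 * K * (v - u)) * (norm (\<gamma> u - M) + e * (v - u)))))" for u v
    from \<open>a \<le> b\<close> have "P a b"
    proof (induction rule: Bolzano)
      case (trans u v w)
      show ?case
        unfolding P_def
      proof (intro impI allI)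
        fix M :: "'n cmat"
        assume "a \<le> u" "w \<le> b" "rank M \<le> r"
        then obtain M1 where M1: "rank M1 \<le> r"
          "norm (\<gamma> v - M1) \<le> exp (2 * K * (v - u)) * (norm (\<gamma> u - M) + e * (v - u))"
          using trans unfolding P_def by (meson order_trans)
        obtain M2 where M2: "rank M2 \<le> r"
          "norm (\<gamma> w - M2) \<le> exp (2 * K * (w - v)) * (norm (\<gamma> v - M1) + e * (w - v))"
          using trans M1(1) \<open>a \<le> u\<close> \<open>w \<le> b\<close> unfolding P_def by (meson order_trans)
        have "e * (w - v) \<le> exp (2 * K * (v - u)) * (e * (w - v))"
          using K0 e trans(3,4) mult_right_mono[of 1 "exp (2 * K * (v - u))" "e * (w - v)"] by simp
        with M1(2) have "norm (\<gamma> v - M1) + e * (w - v)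
            \<le> exp (2 * K * (v - u)) * (norm (\<gamma> u - M) + e * (v - u) + e * (w - v))"
          by (simp add: distrib_left)
        then have "exp (2 * K * (w - v)) * (norm (\<gamma> v - M1) + e * (w - v))
            \<le> exp (2 * K * (w - v)) * (exp (2 * K * (v - u)) * (norm (\<gamma> u - M) + e * (v - u) + e * (w - v)))"
          by (intro mult_left_mono) auto
        also have "\<dots> = exp (2 * K * (w - u)) * (norm (\<gamma> u - M) + e * (w - u))"
          by (simp add: algebra_simps flip: exp_add)
        finally show "\<exists>M'. rank M' \<le> r \<and>
            norm (\<gamma> w - M') \<le> exp (2 * K * (w - u)) * (norm (\<gamma> u - M) + e * (w - u))"
          using M2 order_trans by blast
      qed
    next
      case (local x)
      then have x: "x \<in> {a..b}"
        by simp
      obtain d where d: "d > 0" "\<forall>u\<in>{a..b}. \<forall>v\<in>{a..b}. u \<le> x \<longrightarrow> x \<le> v \<longrightarrow> v - u < d \<longrightarrow>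
          norm (\<gamma> v - euler_step (v - u) (A x) (B x) (\<gamma> u)) \<le> e * (v - u)"
        using euler_step_local_error[OF der[OF x] c(2) c(1) K[OF x] x e] by blast
      have "P u v" if uv: "u \<le> x" "x \<le> v" "v - u < d" for u v
        unfolding P_def
      proof (intro impI allI)
        fix M :: "'n cmat"
        assume ab: "a \<le> u" "v \<le> b" and M: "rank M \<le> r"
        let ?E = "euler_step (v - u) (A x) (B x)"
        have "norm (\<gamma> v - ?E M) \<le> norm (\<gamma> v - ?E (\<gamma> u)) + norm (?E (\<gamma> u - M))"
          using norm_triangle_ineq[of "\<gamma> v - ?E (\<gamma> u)" "?E (\<gamma> u - M)"] by (simp add: euler_step_diff)
        also have "norm (?E (\<gamma> u - M)) \<le> exp (2 * K * (v - u)) * norm (\<gamma> u - M)"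
          using euler_step_bounds(1)[OF c(2) c(1) K[OF x]] uv by simp
        also have "norm (\<gamma> v - ?E (\<gamma> u)) \<le> e * (v - u)"
          using d(2) uv ab by simp
        also have "e * (v - u) \<le> exp (2 * K * (v - u)) * (e * (v - u))"
          using K0 e uv mult_right_mono[of 1 "exp (2 * K * (v - u))" "e * (v - u)"] by simp
        finally have "norm (\<gamma> v - ?E M) \<le> exp (2 * K * (v - u)) * (norm (\<gamma> u - M) + e * (v - u))"
          by (simp add: algebra_simps)
        moreover have "rank (?E M) \<le> r"
          using M rank_euler_step_le order_trans by blast
        ultimately show "\<exists>M'. rank M' \<le> r \<and>
            norm (\<gamma> v - M') \<le> exp (2 * K * (v - u)) * (norm (\<gamma> u - M) + e * (v - u))"
          by blast
      qed
      then show ?case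
        using d(1) by blast
    qed
    then show ?thesis
      using that(1) unfolding P_def by blast
  qed
  have "\<exists>M\<in>{M. rank M \<le> r}. dist M (\<gamma> b) < \<epsilon>" if "0 < \<epsilon>" for \<epsilon>
  proof -
    define q where "q = exp (2 * K * (b - a)) * (b - a)"
    have q: "0 \<le> q"
      using \<open>a \<le> b\<close> by (simp add: q_def)
    define e where "e = \<epsilon> / (q + 1)"
    have e: "0 < e"
      using q that by (simp add: e_def)
    obtain M where M: "rank M \<le> r" "norm (\<gamma> b - M) \<le> exp (2 * K * (b - a)) * (norm (\<gamma> a - \<gamma> a) + e * (b - a))"
      using approx[OF \<open>rank (\<gamma> a) \<le> r\<close> e] by blast
    then have "norm (\<gamma> b - M) \<le> e * q"
      by (simp add: q_def mult_ac)
    also have "\<dots> < \<epsilon>"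
      using q that by (simp add: e_def field_simps)
    finally show ?thesis
      using M(1) by (auto simp: dist_norm norm_minus_commute)
  qed
  then have "\<gamma> b \<in> closure {M. rank M \<le> r}"
    by (simp add: closure_approachable)
  then show ?thesis
    using closure_closed[OF closed_rank_le] by blast
qed

text \<open>
  Backward in time, \<open>u \<mapsto> \<gamma> (- u)\<close> solves the equation with coefficients \<open>- A (- u)\<close> and
  \<open>- B (- u)\<close>.
\<close>

lemma rank_le_along_linear_flow:
  fixes \<gamma> A B :: "real \<Rightarrow> 'n::finite cmat"
  assumes I: "is_interval I" "s \<in> I" "t \<in> I"
    and der: "\<And>t. t \<in> I \<Longrightarrow> (\<gamma> has_vector_derivative A t ** \<gamma> t + \<gamma> t ** B t) (at t within I)"
    and cont: "continuous_on I A" "continuous_on I B"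
    and "rank (\<gamma> s) \<le> r"
  shows "rank (\<gamma> t) \<le> r"
proof (cases "s \<le> t")
  case True
  have sub: "{s..t} \<subseteq> I"
    using I by (metis mem_is_interval_1_I atLeastAtMost_iff subsetI)
  show ?thesis
  proof (rule rank_le_forward[OF True])
    show "(\<gamma> has_vector_derivative A u ** \<gamma> u + \<gamma> u ** B u) (at u within {s..t})" if "u \<in> {s..t}" for u
      using der sub that has_vector_derivative_within_subset by blast
  qed (use cont sub continuous_on_subset assms in blast)+
next
  case False
  have sub: "uminus ` {-s..-t} \<subseteq> I"
  proof
    fix v assume "v \<in> uminus ` {-s..-t}"
    then show "v \<in> I"
      using mem_is_interval_1_I[OF I(1,3,2), of v] by auto
  qed
  have "rank (\<gamma> (- (- t))) \<le> r"
  proof (rule rank_le_forward[where a = "-s" and \<gamma> = "\<lambda>u. \<gamma> (- u)" and A = "\<lambda>u. - A (- u)" and B = "\<lambda>u. - B (- u)"])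
    show "((\<lambda>u. \<gamma> (- u)) has_vector_derivative - A (- u) ** \<gamma> (- u) + \<gamma> (- u) ** - B (- u))
        (at u within {- s..- t})" if u: "u \<in> {- s..- t}" for u
    proof -
      have "(uminus has_vector_derivative (-1)) (at u within {- s..- t})"
        by (auto intro!: derivative_eq_intros)
      moreover have "(\<gamma> has_vector_derivative A (- u) ** \<gamma> (- u) + \<gamma> (- u) ** B (- u))
          (at (- u) within uminus ` {- s..- t})"
        using der sub u by (metis (no_types) has_vector_derivative_within_subset imageI subsetD)
      ultimately have "((\<gamma> \<circ> uminus) has_vector_derivative
          - 1 *\<^sub>R (A (- u) ** \<gamma> (- u) + \<gamma> (- u) ** B (- u))) (at u within {- s..- t})"
        by (rule vector_diff_chain_within)
      then show ?thesis
        by (simp add: o_def matmul.minus_left matmul.minus_right)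
    qed
  qed (use False cont sub assms in \<open>auto intro!: continuous_intros continuous_on_compose2[of I]\<close>)
  then show ?thesis
    by simp
qed

section \<open>Vector fields tangent to the orbits of left and right multiplication\<close>

text \<open>
  The matrices \<open>L a + a R\<close> are the tangent vectors at \<open>a\<close> to its orbit under
  \<open>(g, h) \<mapsto> g a h\<^sup>-\<^sup>1\<close>, and the orbits are the sets of matrices of equal rank. The coefficients \<open>L\<close>
  and \<open>R\<close> are required to depend continuously on \<open>a\<close>, so that along a curve they become the
  coefficients of a linear equation.
\<close>

definition orbit_tangent :: "('n::finite cmat \<Rightarrow> 'n cmat) \<Rightarrow> bool"
  where "orbit_tangent X \<longleftrightarrow> (\<exists>L R. continuous_on UNIV L \<and> continuous_on UNIV R \<and>
    (\<forall>a. X a = L a ** a + a ** R a))"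

lemma orbit_tangent_zero: "orbit_tangent (\<lambda>a. 0)"
  unfolding orbit_tangent_def
  by (intro exI[of _ "\<lambda>a. 0"]) auto

lemma orbit_tangent_add:
  assumes "orbit_tangent X" "orbit_tangent Y"
  shows "orbit_tangent (\<lambda>a. X a + Y a)"
proof -
  obtain L R L' R' where "continuous_on UNIV L" "continuous_on UNIV R" "\<And>a. X a = L a ** a + a ** R a"
    "continuous_on UNIV L'" "continuous_on UNIV R'" "\<And>a. Y a = L' a ** a + a ** R' a"
    using assms unfolding orbit_tangent_def by blast
  then show ?thesis
    unfolding orbit_tangent_def
    by (intro exI[of _ "\<lambda>a. L a + L' a"] exI[of _ "\<lambda>a. R a + R' a"])
      (auto intro!: continuous_intros simp: matrix_add_ldistrib matrix_mult_add_left)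
qed

lemma orbit_tangent_sum:
  assumes "finite S" "\<And>i. i \<in> S \<Longrightarrow> orbit_tangent (X i)"
  shows "orbit_tangent (\<lambda>a. \<Sum>i\<in>S. X i a)"
  using assms by (induction S) (auto intro: orbit_tangent_zero orbit_tangent_add)

lemma orbit_tangent_scale:
  assumes "continuous_on UNIV c" "orbit_tangent X"
  shows "orbit_tangent (\<lambda>a. \<chi> s t. c a * X a $ s $ t)"
proof -
  obtain L R where LR: "continuous_on UNIV L" "continuous_on UNIV R" "\<And>a. X a = L a ** a + a ** R a"
    using assms unfolding orbit_tangent_def by blast
  have "(\<chi> s t. c a * X a $ s $ t) = (\<chi> s t. c a * L a $ s $ t) ** a + a ** (\<chi> s t. c a * R a $ s $ t)" for a
    by (simp add: vec_eq_iff LR(3) matrix_matrix_mult_def sum_distrib_left algebra_simps)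
  moreover have "continuous_on UNIV (\<lambda>a. \<chi> s t. c a * L a $ s $ t)"
    "continuous_on UNIV (\<lambda>a. \<chi> s t. c a * R a $ s $ t)"
    using LR(1,2) assms(1) by (auto intro!: continuous_intros)
  ultimately show ?thesis
    unfolding orbit_tangent_def by blast
qed

lemma rank_le_along_orbit_tangent_field:
  assumes "orbit_tangent X" "integral_curve X I \<gamma>" "s \<in> I" "t \<in> I" "rank (\<gamma> s) \<le> r"
  shows "rank (\<gamma> t) \<le> r"
proof -
  obtain L R where LR: "continuous_on UNIV L" "continuous_on UNIV R" "\<And>a. X a = L a ** a + a ** R a"
    using assms unfolding orbit_tangent_def by blast
  have I: "is_interval I"
    and der: "\<And>u. u \<in> I \<Longrightarrow> (\<gamma> has_vector_derivative L (\<gamma> u) ** \<gamma> u + \<gamma> u ** R (\<gamma> u)) (at u within I)"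
    using assms(2) by (auto simp: integral_curve_def LR(3))
  have "continuous_on I \<gamma>"
    using der by (meson continuous_on_eq_continuous_within has_vector_derivative_continuous)
  then have "continuous_on I (\<lambda>u. L (\<gamma> u))" "continuous_on I (\<lambda>u. R (\<gamma> u))"
    using LR(1,2) by (auto intro: continuous_on_compose2)
  then show ?thesis
    using rank_le_along_linear_flow[OF I assms(3,4) der] assms(5) by blast
qed

section \<open>Hamiltonian fields of the modified bracket\<close>

text \<open>
  The pairing is the sum of a function of the row and a function of the column, because each basis
  weight depends on at most one of them; the value at any base point \<open>(i, j)\<close> then determines
  the constant.
\<close>

lemma pairing_separates: "pairing s t l = pairing s j l + pairing i t l - pairing i j l"
proof -
  have "basis_pairing b s t = basis_pairing b s j + basis_pairing b i t - basis_pairing b i j" for b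
    by (cases b) auto
  then have "pairing s t l = (\<Sum>b\<in>Poly_Mapping.keys l. Poly_Mapping.lookup l b *
      (basis_pairing b s j + basis_pairing b i t - basis_pairing b i j))"
    unfolding pairing_def by presburger
  then show ?thesis
    by (simp add: pairing_def algebra_simps sum.distrib sum_subtractf)
qed

definition index_sign :: "'n::linorder \<Rightarrow> 'n \<Rightarrow> complex"
  where "index_sign i s = (if i < s then 1 else if s < i then - 1 else 0)"

text \<open>
  The uniform formula behind the four prescribed cases. For fixed \<open>(i, j)\<close>, the products
  \<open>a $ s $ j * a $ i $ t\<close> are the entries of column \<open>j\<close> times row \<open>i\<close>; the first sign scales the rows
  of that matrix and the second one its columns.
\<close>

lemma std_bracket_eq:
  "std_bracket i j s t a = (index_sign i s + index_sign j t) * (a $ s $ j * a $ i $ t)"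
  by (auto simp: std_bracket_def bracket_half_def index_sign_def)

text \<open>
  The standard part is \<open>(D c) (e\<^sub>i\<^sup>T a) + (a e\<^sub>j) (r D')\<close>, where \<open>c\<close> is column \<open>j\<close> and \<open>r\<close> is row \<open>i\<close>
  of \<open>a\<close>, and \<open>D\<close>, \<open>D'\<close> are diagonal matrices of signs. In the modification the coefficient of
  \<open>a $ i $ j * a $ s $ t\<close> is a function \<open>x\<close> of \<open>s\<close> plus a function \<open>y\<close> of \<open>t\<close>, which scales the rows
  and the columns of \<open>a\<close>.
\<close>

lemma orbit_tangent_coord_field: "orbit_tangent (coord_field \<zeta> \<xi> i j)"
proof -
  define l where "l = \<zeta> i + \<xi> j"
  define x where "x s = (of_int (pairing s j l - pairing i j (\<zeta> s)) :: complex)" for s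
  define y where "y t = (of_int (pairing i t l - pairing i j l - pairing i j (\<xi> t)) :: complex)" for t
  define L :: "'a cmat \<Rightarrow> 'a cmat" where "L a = (\<chi> s k. (if k = i then index_sign i s * a $ s $ j else 0)
      + (if k = s then x s * a $ i $ j else 0))" for a
  define R :: "'a cmat \<Rightarrow> 'a cmat" where "R a = (\<chi> k t. (if k = j then index_sign j t * a $ i $ t else 0)
      + (if k = t then y t * a $ i $ j else 0))" for a
  have "of_int (pairing s t (\<zeta> i + \<xi> j) - pairing i j (\<zeta> s + \<xi> t)) = x s + y t" for s t
    unfolding l_def[symmetric] pairing_add x_def y_def
    by (subst pairing_separates[of s t l j i]) simp
  then have "coord_field \<zeta> \<xi> i j a $ s $ t
      = (index_sign i s + index_sign j t) * (a $ s $ j * a $ i $ t) + (x s + y t) * (a $ i $ j * a $ s $ t)" for a s t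
    by (simp add: coord_field_def mod_bracket_def std_bracket_eq)
  moreover have "(L a ** a) $ s $ t = index_sign i s * a $ s $ j * a $ i $ t + x s * a $ i $ j * a $ s $ t" for a s t
    by (simp add: L_def matrix_matrix_mult_def distrib_right sum.distrib if_distrib[of "\<lambda>z. z * _"] cong: if_cong)
  moreover have "(a ** R a) $ s $ t = a $ s $ j * (index_sign j t * a $ i $ t) + a $ s $ t * (y t * a $ i $ j)" for a s t
    by (simp add: R_def matrix_matrix_mult_def distrib_left sum.distrib if_distrib[of "\<lambda>z. _ * z"] cong: if_cong)
  ultimately have "coord_field \<zeta> \<xi> i j a = L a ** a + a ** R a" for a
    by (simp add: vec_eq_iff algebra_simps)
  moreover have "continuous_on UNIV (\<lambda>a :: 'a cmat. (if k = i then index_sign i s * a $ s $ j else 0)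
      + (if k = s then x s * a $ i $ j else 0))" for k s
    by (cases "k = i"; cases "k = s") (auto intro!: continuous_intros)
  then have "continuous_on UNIV L"
    unfolding L_def by (intro continuous_on_vec_lambda)
  moreover have "continuous_on UNIV (\<lambda>a :: 'a cmat. (if k = j then index_sign j t * a $ i $ t else 0)
      + (if k = t then y t * a $ i $ j else 0))" for k t
    by (cases "k = j"; cases "k = t") (auto intro!: continuous_intros)
  then have "continuous_on UNIV R"
    unfolding R_def by (intro continuous_on_vec_lambda)
  ultimately show ?thesis
    unfolding orbit_tangent_def by blast
qed

lemma continuous_on_hol_partial:
  assumes "smooth f"
  shows "continuous_on UNIV (hol_partial i j f)"
proof -
  have "times_differentiable (Suc 0) f"
    using assms unfolding smooth_def by blast
  then have "continuous_on UNIV (\<lambda>a. frechet_derivative f (at a) v)" for v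
    by simp
  then show ?thesis
    unfolding hol_partial_def by (intro continuous_intros) auto
qed

text \<open>
  Since \<open>f\<close> is smooth, its Hamiltonian field is a combination of the coordinate fields with continuous
  coefficients.
\<close>

lemma orbit_tangent_hamiltonian_field:
  assumes "smooth f"
  shows "orbit_tangent (hamiltonian_field \<zeta> \<xi> f)"
proof -
  have "hamiltonian_field \<zeta> \<xi> f = (\<lambda>a. \<Sum>i\<in>UNIV. \<Sum>j\<in>UNIV.
      \<chi> s t. hol_partial i j f a * coord_field \<zeta> \<xi> i j a $ s $ t)"
    by (simp add: fun_eq_iff vec_eq_iff hamiltonian_field_def)
  moreover have "orbit_tangent (\<lambda>a. \<Sum>i\<in>UNIV. \<Sum>j\<in>UNIV.
      \<chi> s t. hol_partial i j f a * coord_field \<zeta> \<xi> i j a $ s $ t)"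
    by (intro orbit_tangent_sum orbit_tangent_scale continuous_on_hol_partial assms
        orbit_tangent_coord_field finite)
  ultimately show ?thesis
    by simp
qed

theorem corollary12p10:
  fixes r :: nat
    and \<zeta> \<xi> :: "'n \<Rightarrow> ('n::{finite,linorder}) weight_basis \<Rightarrow>\<^sub>0 int"
    and f :: "'n cmat \<Rightarrow> complex"
    and \<gamma> :: "real \<Rightarrow> 'n cmat"
    and I :: "real set" and t\<^sub>0 :: real
  assumes "r \<le> CARD('n)"
    and "\<And>i. \<zeta> i \<in> carrier weight_lattice"
    and "\<And>i. \<xi> i \<in> carrier weight_lattice"
    and "smooth f"
    and "integral_curve (hamiltonian_field \<zeta> \<xi> f) I \<gamma>"
    and "t\<^sub>0 \<in> I"
    and "rank (\<gamma> t\<^sub>0) \<le> r"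
  shows "\<forall>t\<in>I. rank (\<gamma> t) \<le> r"
  using rank_le_along_orbit_tangent_field[OF orbit_tangent_hamiltonian_field[OF assms(4)] assms(5,6)] assms(7)
  by blast

end
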